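(* Let $S$ be a $*$-monoid, let $a\in S$ and let $n\geq 1$ be an integer. Then the following conditions are equivalent: (i) $a$ is pseudo core invertible with pseudo core index ${\rm I}(a)=n$. (ii) $a^n$ is $a$-core invertible. (iii) $a^n$ is core invertible. In this case, writing $a^{D,c}$ for the pseudo core inverse of $a$, $(a^n)_a^{\#}$ for the $a$-core inverse of $a^n$, and $(a^n)^{c}$ for the core inverse of $a^n$, one has $a^{D,c}=a^n(a^n)_a^{\#}=a^{n-1}(a^n)^{c}$.
   Context: A $*$-monoid is a semigroup $S$ with identity $1$ and a map $*$ satisfying $(x^* )^*=x$ and $(xy)^*=y^*x^*$ for all $x,y\in S$; powers use $a^0=1$. For $b,w\in S$, $b$ is $w$-core invertible if there exists $x\in S$ with $bwx^2=x$, $xbwb=b$ and $(bwx)^*=bwx$. Such an $x$ is unique if it exists, is called the $w$-core inverse of $b$, and is denoted here by $b_w^{\#}$. The case $w=1$ is the core inverse: $b$ is core invertible if there is $x\in S$ with $bx^2=x$, $xb^2=b$, $(bx)^*=bx$; this unique $x$ is the core inverse of $b$. An element $a\in S$ is pseudo core invertible if there exist $x\in S$ and a positive integer $m$ with $xa^{m+1}=a^m$, $ax^2=x$ and $(ax)^*=ax$. Such an $x$ is unique if it exists and is called the pseudo core inverse of $a$. The smallest such positive integer $m$ is called the pseudo core index of $a$, denoted ${\rm I}(a)$.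
   Formalization: In condition (i) the index equality I(a) = n is replaced by I(a) ≤ n, since the equivalence fails with equality (a = 1, n = 2: a² is core invertible and a-core invertible, but I(a) = 1). *)

theory Defs
  imports Main
begin

class star_monoid = monoid_mult +
  fixes star :: "'a \<Rightarrow> 'a"
  assumes star_star: "star (star x) = x"
    and star_mult: "star (x * y) = star y * star x"

definition is_w_core_inverse :: "'a::star_monoid \<Rightarrow> 'a \<Rightarrow> 'a \<Rightarrow> bool" where
  "is_w_core_inverse w b x \<longleftrightarrow>
     b * w * x ^ 2 = x \<and> x * b * w * b = b \<and> star (b * w * x) = b * w * x"

definition w_core_invertible :: "'a::star_monoid \<Rightarrow> 'a \<Rightarrow> bool" where
  "w_core_invertible w b \<longleftrightarrow> (\<exists>x. is_w_core_inverse w b x)"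

definition w_core_inverse :: "'a::star_monoid \<Rightarrow> 'a \<Rightarrow> 'a" where
  "w_core_inverse w b = (THE x. is_w_core_inverse w b x)"

definition is_core_inverse :: "'a::star_monoid \<Rightarrow> 'a \<Rightarrow> bool" where
  "is_core_inverse b x \<longleftrightarrow> b * x ^ 2 = x \<and> x * b ^ 2 = b \<and> star (b * x) = b * x"

definition core_invertible :: "'a::star_monoid \<Rightarrow> bool" where
  "core_invertible b \<longleftrightarrow> (\<exists>x. is_core_inverse b x)"

definition core_inverse :: "'a::star_monoid \<Rightarrow> 'a" where
  "core_inverse b = (THE x. is_core_inverse b x)"

definition is_pseudo_core_inverse_exp :: "'a::star_monoid \<Rightarrow> nat \<Rightarrow> 'a \<Rightarrow> bool" where
  "is_pseudo_core_inverse_exp a m x \<longleftrightarrow>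
     0 < m \<and> x * a ^ (m + 1) = a ^ m \<and> a * x ^ 2 = x \<and> star (a * x) = a * x"

definition is_pseudo_core_inverse :: "'a::star_monoid \<Rightarrow> 'a \<Rightarrow> bool" where
  "is_pseudo_core_inverse a x \<longleftrightarrow> (\<exists>m. is_pseudo_core_inverse_exp a m x)"

definition pseudo_core_invertible :: "'a::star_monoid \<Rightarrow> bool" where
  "pseudo_core_invertible a \<longleftrightarrow> (\<exists>x. is_pseudo_core_inverse a x)"

definition pseudo_core_inverse :: "'a::star_monoid \<Rightarrow> 'a" where
  "pseudo_core_inverse a = (THE x. is_pseudo_core_inverse a x)"

text \<open>
  The exponents m that work for a given element are upward closed, so solvability for the exponent n
  means that the index is at most n, not that it equals n.  It is the former condition that is
  equivalent to core invertibility of the n-th power: the identity has index 1, although all its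
  powers are core invertible.
\<close>

definition pseudo_core_index :: "'a::star_monoid \<Rightarrow> nat" where
  "pseudo_core_index a = (LEAST m. \<exists>x. is_pseudo_core_inverse_exp a m x)"

lemma is_core_inverse_iff_w_core_1: "is_core_inverse b x \<longleftrightarrow> is_w_core_inverse 1 b x"
  by (simp add: is_core_inverse_def is_w_core_inverse_def power2_eq_square mult.assoc)

end

theory Submission
  imports Defs
begin

text \<open>
  A pseudo core inverse \<open>x\<close> of \<open>a\<close> with exponent \<open>n\<close> satisfies \<open>a ^ k * x ^ k = a * x\<close> for
  \<open>k \<ge> 1\<close> and \<open>x ^ k * a ^ (n + k) = a ^ n\<close>, so \<open>x ^ (n + 1)\<close> is an \<open>a\<close>-core inverse and
  \<open>x ^ n\<close> a core inverse of \<open>a ^ n\<close>.  Conversely, an \<open>a\<close>-core inverse \<open>y\<close> or a core inverse \<open>z\<close>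
  of \<open>a ^ n\<close> yields the pseudo core inverse \<open>a ^ n * y\<close>, respectively \<open>a ^ (n - 1) * z\<close>; here
  \<open>x * a ^ (n + 1) = a ^ n\<close> holds because \<open>a ^ n\<close> is a right multiple of \<open>a ^ (2 * n)\<close>.  The
  formulas come from uniqueness of the inverses.
\<close>

section \<open>Uniqueness of \<open>w\<close>-core and core inverses\<close>

context
  fixes w b y :: "'a::star_monoid"
  assumes y: "is_w_core_inverse w b y"
begin

lemma w_core_inverse_outer_square: "b * w * y * y = y"
  using y by (simp add: is_w_core_inverse_def power2_eq_square mult.assoc)

lemma w_core_inverse_absorb: "y * b * w * b = b"
  using y by (simp add: is_w_core_inverse_def)

lemma w_core_inverse_star: "star (b * w * y) = b * w * y"
  using y by (simp add: is_w_core_inverse_def)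

text \<open>Expanding the last \<open>b\<close> to \<open>y * b * w * b\<close> produces the factor
  \<open>b * w * y * y\<close>, which collapses to \<open>y\<close>.\<close>

lemma w_core_inverse_inner: "b * w * y * b = b"
proof -
  have "b * w * y * b = b * w * y * (y * b * w * b)"
    by (simp only: w_core_inverse_absorb)
  also have "\<dots> = (b * w * y * y) * b * w * b"
    by (simp only: mult.assoc)
  also have "\<dots> = b"
    by (simp only: w_core_inverse_outer_square w_core_inverse_absorb)
  finally show ?thesis .
qed

end

text \<open>The case \<open>z = y\<close> recovers \<open>y\<close> from the product
  \<open>b * w * y\<close>, so uniqueness reduces to comparing these products.\<close>

lemma w_core_inverse_mult_right:
  assumes "is_w_core_inverse w b y" and "is_w_core_inverse w b z"
  shows "y * (b * w * z) = z"
proof -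
  have "y * (b * w * z) = y * (b * w * (b * w * z * z))"
    by (simp only: w_core_inverse_outer_square[OF assms(2)])
  also have "\<dots> = (y * b * w * b) * w * z * z"
    by (simp only: mult.assoc)
  also have "\<dots> = z"
    by (simp only: w_core_inverse_absorb[OF assms(1)] w_core_inverse_outer_square[OF assms(2)])
  finally show ?thesis .
qed

text \<open>Applying \<open>star\<close> to \<open>p * q = q\<close> gives \<open>q * p = q\<close>,
  while \<open>q * p = p\<close>. This is the fact that a projection is determined by the right
  ideal it generates.\<close>

lemma star_fixed_eqI:
  fixes p q :: "'a::star_monoid"
  assumes "star p = p" and "star q = q" and "p * q = q" and "q * p = p"
  shows "p = q"
  by (metis assms star_mult)

lemma is_w_core_inverse_unique:
  assumes "is_w_core_inverse w b y" and "is_w_core_inverse w b z"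
  shows "y = z"
proof -
  have absorb: "(b * w * u) * (b * w * v) = b * w * v" if "is_w_core_inverse w b u" for u v
    using w_core_inverse_inner[OF that] by (metis mult.assoc)
  have "b * w * y = b * w * z"
    by (rule star_fixed_eqI[OF w_core_inverse_star[OF assms(1)] w_core_inverse_star[OF assms(2)]
          absorb[OF assms(1)] absorb[OF assms(2)]])
  then show ?thesis
    using w_core_inverse_mult_right[OF assms(1,1)] w_core_inverse_mult_right[OF assms] by metis
qed

lemma w_core_inverse_eqI: "is_w_core_inverse w b y \<Longrightarrow> w_core_inverse w b = y"
  unfolding w_core_inverse_def using is_w_core_inverse_unique by blast

lemma core_inverse_eqI: "is_core_inverse b y \<Longrightarrow> core_inverse b = y"
  unfolding core_inverse_def is_core_inverse_iff_w_core_1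
  using is_w_core_inverse_unique by blast

section \<open>Powers of a pseudo core inverse\<close>

context
  fixes a x :: "'a::star_monoid" and m :: nat
  assumes x: "is_pseudo_core_inverse_exp a m x"
begin

lemma pseudo_core_inverse_outer_square: "a * x * x = x"
  using x by (simp add: is_pseudo_core_inverse_exp_def power2_eq_square mult.assoc)

lemma pseudo_core_inverse_star: "star (a * x) = a * x"
  using x by (simp add: is_pseudo_core_inverse_exp_def)

lemma power_mult_pseudo_core_inverse_Suc: "a ^ k * x ^ Suc k = x"
proof (induction k)
  case (Suc k)
  \<comment> \<open>Peeling \<open>a\<close> off on the left and \<open>x\<close> off on the right
    leaves the induction hypothesis in the middle.\<close>
  have "a ^ Suc k * x ^ Suc (Suc k) = a * (a ^ k * x ^ Suc k) * x"
    by (simp only: power_Suc2[of x] power_Suc[of a] mult.assoc)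
  then show ?case
    by (simp only: Suc.IH pseudo_core_inverse_outer_square)
qed simp

lemma power_mult_pseudo_core_inverse:
  assumes "0 < k"
  shows "a ^ k * x ^ k = a * x"
proof -
  obtain j where "k = Suc j"
    using assms gr0_implies_Suc by blast
  then show ?thesis
    using power_mult_pseudo_core_inverse_Suc[of j] by (simp add: mult.assoc)
qed

text \<open>Lets two inverses with different exponents be compared at a common one, and turns a
  bound on the index into solvability at exponent \<open>n\<close>.\<close>

lemma pseudo_core_inverse_exp_mono:
  assumes "m \<le> k"
  shows "is_pseudo_core_inverse_exp a k x"
proof -
  obtain d where d: "k = m + d"
    using assms le_Suc_ex by blast
  have "x * a ^ (k + 1) = x * a ^ (m + 1) * a ^ d"
    by (simp add: d mult.assoc add.commute flip: power_add power_Suc)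
  with x show ?thesis
    by (simp add: d is_pseudo_core_inverse_exp_def power_add)
qed

lemma pseudo_core_inverse_power_mult: "x ^ k * a ^ (m + k) = a ^ m"
proof (induction k)
  case (Suc k)
  have "x * a ^ (m + k + 1) = a ^ (m + k)"
    using pseudo_core_inverse_exp_mono[of "m + k"] by (simp add: is_pseudo_core_inverse_exp_def)
  then have "x ^ Suc k * a ^ (m + Suc k) = x ^ k * a ^ (m + k)"
    by (simp add: power_Suc2 mult.assoc del: power_Suc)
  with Suc.IH show ?case
    by simp
qed simp

lemma pseudo_core_inverse_inner: "a * x * a ^ m = a ^ m"
proof -
  have "x * a ^ (m + 1) = a ^ m"
    using x by (simp add: is_pseudo_core_inverse_exp_def)
  then show ?thesis
    by (metis (no_types) mult.assoc pseudo_core_inverse_outer_square)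
qed

lemma is_w_core_inverse_power_pseudo:
  "is_w_core_inverse a (a ^ m) (x ^ Suc m)"
proof -
  \<comment> \<open>The weight \<open>a\<close> raises the exponent to \<open>m + 1\<close>, hence
    the witness \<open>x ^ Suc m\<close>; the resulting projection is again
    \<open>a * x\<close>.\<close>
  have p: "a ^ m * a * x ^ Suc m = a * x"
    using power_mult_pseudo_core_inverse[of "Suc m"] by (simp only: power_Suc2 zero_less_Suc)
  have "a ^ m * a * (x ^ Suc m)\<^sup>2 = (a ^ m * a * x ^ Suc m) * x ^ Suc m"
    by (simp only: power2_eq_square mult.assoc)
  also have "\<dots> = x ^ Suc m"
    unfolding p by (simp only: power_Suc pseudo_core_inverse_outer_square flip: mult.assoc)
  finally have "a ^ m * a * (x ^ Suc m)\<^sup>2 = x ^ Suc m" .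
  moreover have "x ^ Suc m * a ^ m * a * a ^ m = a ^ m"
    using pseudo_core_inverse_power_mult[of "Suc m"]
    by (simp only: power_add power_Suc mult.assoc)
  ultimately show ?thesis
    using p by (simp only: is_w_core_inverse_def pseudo_core_inverse_star)
qed

lemma is_core_inverse_power_pseudo: "is_core_inverse (a ^ m) (x ^ m)"
proof -
  have m: "0 < m"
    using x by (simp add: is_pseudo_core_inverse_exp_def)
  then obtain j where j: "m = Suc j"
    using gr0_implies_Suc by blast
  have p: "a ^ m * x ^ m = a * x"
    using m by (rule power_mult_pseudo_core_inverse)
  have "a ^ m * (x ^ m)\<^sup>2 = a * x * x ^ m"
    by (simp only: power2_eq_square p flip: mult.assoc)
  also have "\<dots> = x ^ m"
    by (simp only: j power_Suc pseudo_core_inverse_outer_square flip: mult.assoc)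
  finally have "a ^ m * (x ^ m)\<^sup>2 = x ^ m" .
  moreover have "x ^ m * (a ^ m)\<^sup>2 = a ^ m"
    using pseudo_core_inverse_power_mult[of m] by (simp only: power2_eq_square power_add)
  ultimately show ?thesis
    using p by (simp only: is_core_inverse_def pseudo_core_inverse_star)
qed

end

text \<open>At a common exponent the projections \<open>a * x\<close> and \<open>a * y\<close>
  absorb each other and so coincide; left multiplication by \<open>x\<close> then recovers both
  inverses.\<close>

lemma is_pseudo_core_inverse_unique:
  assumes "is_pseudo_core_inverse a x" and "is_pseudo_core_inverse a y"
  shows "x = y"
proof -
  obtain i j where "is_pseudo_core_inverse_exp a i x" "is_pseudo_core_inverse_exp a j y"
    using assms by (auto simp: is_pseudo_core_inverse_def)
  then obtain m where x: "is_pseudo_core_inverse_exp a m x" and y: "is_pseudo_core_inverse_exp a m y"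
    by (meson pseudo_core_inverse_exp_mono max.cobounded1 max.cobounded2)
  have m: "0 < m"
    using x by (simp add: is_pseudo_core_inverse_exp_def)
  have absorb: "(a * u) * (a * v) = a * v"
    if "is_pseudo_core_inverse_exp a m u" "is_pseudo_core_inverse_exp a m v" for u v
  proof -
    \<comment> \<open>Writing \<open>a * v\<close> as \<open>a ^ m * v ^ m\<close> exposes
      \<open>a ^ m\<close>, on which \<open>a * u\<close> acts as a left identity.\<close>
    have "(a * u) * (a * v) = (a * u * a ^ m) * v ^ m"
      by (simp only: mult.assoc power_mult_pseudo_core_inverse[OF that(2) m])
    also have "\<dots> = a * v"
      by (simp only: pseudo_core_inverse_inner[OF that(1)] power_mult_pseudo_core_inverse[OF that(2) m])
    finally show ?thesis .
  qed
  have eq: "a * x = a * y"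
    by (rule star_fixed_eqI[OF pseudo_core_inverse_star[OF x] pseudo_core_inverse_star[OF y]
          absorb[OF x y] absorb[OF y x]])
  have right: "x * (a * v) = v" if v: "is_pseudo_core_inverse_exp a m v" for v
  proof -
    have "x * (a * v) = x * a ^ (m + 1) * v ^ Suc m"
      using power_mult_pseudo_core_inverse[OF v, of "Suc m"] by (simp add: mult.assoc)
    also have "\<dots> = a ^ m * v ^ Suc m"
      using x by (simp add: is_pseudo_core_inverse_exp_def)
    also have "\<dots> = v"
      by (rule power_mult_pseudo_core_inverse_Suc[OF v])
    finally show ?thesis .
  qed
  show ?thesis
    by (rule trans[OF right[OF x, symmetric, unfolded eq] right[OF y]])
qed

lemma pseudo_core_inverse_eqI: "is_pseudo_core_inverse_exp a m x \<Longrightarrow> pseudo_core_inverse a = x"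
  unfolding pseudo_core_inverse_def
  using is_pseudo_core_inverse_unique is_pseudo_core_inverse_def by blast

text \<open>Invertibility is stated separately because \<open>LEAST\<close> is unspecified when no
  exponent works.\<close>

lemma pseudo_core_index_le_iff:
  "pseudo_core_invertible a \<and> pseudo_core_index a \<le> n \<longleftrightarrow> (\<exists>x. is_pseudo_core_inverse_exp a n x)"
proof
  assume *: "pseudo_core_invertible a \<and> pseudo_core_index a \<le> n"
  then have "\<exists>m x. is_pseudo_core_inverse_exp a m x"
    by (auto simp: pseudo_core_invertible_def is_pseudo_core_inverse_def)
  then have "\<exists>x. is_pseudo_core_inverse_exp a (pseudo_core_index a) x"
    unfolding pseudo_core_index_def by (rule LeastI_ex)
  with * show "\<exists>x. is_pseudo_core_inverse_exp a n x"
    using pseudo_core_inverse_exp_mono by blast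
next
  assume *: "\<exists>x. is_pseudo_core_inverse_exp a n x"
  then have "pseudo_core_index a \<le> n"
    unfolding pseudo_core_index_def by (rule Least_le)
  with * show "pseudo_core_invertible a \<and> pseudo_core_index a \<le> n"
    by (auto simp: pseudo_core_invertible_def is_pseudo_core_inverse_def)
qed

section \<open>From inverses of \<open>a ^ n\<close> back to pseudo core inverses of
  \<open>a\<close>\<close>

lemma is_pseudo_core_inverse_exp_of_w_core:
  fixes a :: "'a::star_monoid"
  assumes "0 < n" and y: "is_w_core_inverse a (a ^ n) y"
  shows "is_pseudo_core_inverse_exp a n (a ^ n * y)"
proof -
  let ?b = "a ^ n"
  have comm: "?b * a = a * ?b" and comm': "?b * (a * u) = a * (?b * u)" for u
    by (simp_all add: power_commutes flip: mult.assoc)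
  note ac = mult.assoc comm comm'
  have "a * (?b * y)\<^sup>2 = (?b * a * y * ?b) * y"
    by (simp only: power2_eq_square ac)
  then have sq: "a * (?b * y)\<^sup>2 = ?b * y"
    by (simp only: w_core_inverse_inner[OF y])
  \<comment> \<open>This witness comes from replacing \<open>y\<close> by
    \<open>?b * a * y * y\<close> in \<open>?b * a * y * ?b = ?b\<close> and moving both powers
    \<open>?b\<close> to the front.\<close>
  define v where "v = a * a * y * y * ?b"
  have "?b = ?b * a * (?b * a * y * y) * ?b"
    by (simp only: w_core_inverse_outer_square[OF y] w_core_inverse_inner[OF y])
  also have "\<dots> = ?b * ?b * v"
    by (simp only: v_def ac)
  finally have v: "?b * ?b * v = ?b" ..
  \<comment> \<open>The extra copy of \<open>?b\<close> is what completes the pattern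
    \<open>y * ?b * a * ?b\<close>.\<close>
  have "?b * y * a ^ (n + 1) = ?b * y * (a * (?b * ?b * v))"
    by (simp only: v) simp
  also have "\<dots> = ?b * (y * ?b * a * ?b) * v"
    by (simp only: ac)
  also have "\<dots> = ?b"
    by (simp only: w_core_inverse_absorb[OF y] v)
  finally have "?b * y * a ^ (n + 1) = ?b" .
  moreover have "star (a * (?b * y)) = a * (?b * y)"
    using w_core_inverse_star[OF y] by (simp only: ac)
  ultimately show ?thesis
    using sq \<open>0 < n\<close> by (simp only: is_pseudo_core_inverse_exp_def)
qed

lemma is_pseudo_core_inverse_exp_of_core:
  fixes a :: "'a::star_monoid"
  assumes "0 < n" and core: "is_core_inverse (a ^ n) z"
  shows "is_pseudo_core_inverse_exp a n (a ^ (n - 1) * z)"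
proof -
  let ?b = "a ^ n" and ?c = "a ^ (n - 1)"
  have z: "is_w_core_inverse 1 ?b z"
    using core by (simp only: is_core_inverse_iff_w_core_1)
  have bzz: "?b * z * z = z" and zbb: "z * ?b * ?b = ?b" and bzb: "?b * z * ?b = ?b"
    and st: "star (?b * z) = ?b * z"
    using w_core_inverse_outer_square[OF z] w_core_inverse_absorb[OF z]
      w_core_inverse_inner[OF z] w_core_inverse_star[OF z] by simp_all
  obtain k where k: "n = Suc k"
    using \<open>0 < n\<close> gr0_implies_Suc by blast
  have a_c: "a * ?c = ?b" and c_a: "?c * a = ?b"
    by (simp_all add: k power_commutes)
  have comm: "?b * a = a * ?b" "?b * ?c = ?c * ?b"
    by (simp_all add: power_commutes add.commute flip: power_add)
  have comm': "?b * (a * u) = a * (?b * u)" "?b * (?c * u) = ?c * (?b * u)" for u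
    by (simp_all only: comm flip: mult.assoc)
  note ac = mult.assoc comm comm'
  have az: "a * (?c * z) = ?b * z"
    by (simp only: a_c flip: mult.assoc)
  have "a * (?c * z)\<^sup>2 = a * (?c * z) * (?c * z)"
    by (simp only: power2_eq_square mult.assoc)
  \<comment> \<open>Expanding the last \<open>z\<close> supplies a \<open>?b\<close> that commutes
    past \<open>?c\<close> and forms \<open>?b * z * ?b\<close>.\<close>
  also have "\<dots> = ?b * z * ?c * (?b * z * z)"
    by (simp only: az bzz) (simp only: mult.assoc)
  also have "\<dots> = (?b * z * ?b) * ?c * z * z"
    by (simp only: ac)
  also have "\<dots> = ?c * (?b * z * z)"
    unfolding bzb by (simp only: ac)
  also have "\<dots> = ?c * z"
    by (simp only: bzz)
  finally have sq: "a * (?c * z)\<^sup>2 = ?c * z" .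
  \<comment> \<open>Again a witness that \<open>?b\<close> is a right multiple of
    \<open>?b * ?b\<close>, since \<open>?b * z * z = z\<close> and
    \<open>?b * z * ?b = ?b\<close>.\<close>
  define v where "v = z * z * ?b"
  have "?b * ?b * v = ?b * (?b * z * z) * ?b"
    by (simp only: v_def mult.assoc)
  then have v: "?b * ?b * v = ?b"
    by (simp only: bzz bzb)
  have "?c * z * a ^ (n + 1) = ?c * z * (a * (?b * ?b * v))"
    by (simp only: v) simp
  also have "\<dots> = ?c * (z * ?b * ?b) * a * v"
    by (simp only: ac)
  also have "\<dots> = (?c * a) * ?b * v"
    unfolding zbb by (simp only: ac)
  also have "\<dots> = ?b"
    by (simp only: c_a v)
  finally show ?thesis
    using sq st az \<open>0 < n\<close> by (simp only: is_pseudo_core_inverse_exp_def)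
qed

theorem proposition2p16:
  fixes a :: "'a::star_monoid" and n :: nat
  assumes "n \<ge> 1"
  shows "((pseudo_core_invertible a \<and> pseudo_core_index a \<le> n) \<longleftrightarrow> w_core_invertible a (a ^ n))
    \<and> (w_core_invertible a (a ^ n) \<longleftrightarrow> core_invertible (a ^ n))
    \<and> (core_invertible (a ^ n) \<longrightarrow>
         pseudo_core_inverse a = a ^ n * w_core_inverse a (a ^ n)
         \<and> a ^ n * w_core_inverse a (a ^ n) = a ^ (n - 1) * core_inverse (a ^ n))"
proof -
  have n: "0 < n"
    using assms by simp
  have i_ii: "(\<exists>x. is_pseudo_core_inverse_exp a n x) \<longleftrightarrow> w_core_invertible a (a ^ n)"
    using is_w_core_inverse_power_pseudo is_pseudo_core_inverse_exp_of_w_core[OF n]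
    unfolding w_core_invertible_def by blast
  have i_iii: "(\<exists>x. is_pseudo_core_inverse_exp a n x) \<longleftrightarrow> core_invertible (a ^ n)"
    using is_core_inverse_power_pseudo is_pseudo_core_inverse_exp_of_core[OF n]
    unfolding core_invertible_def by blast
  have "pseudo_core_inverse a = a ^ n * w_core_inverse a (a ^ n)
      \<and> a ^ n * w_core_inverse a (a ^ n) = a ^ (n - 1) * core_inverse (a ^ n)"
    if inv: "core_invertible (a ^ n)"
  proof -
    obtain y where y: "is_w_core_inverse a (a ^ n) y"
      using inv i_ii i_iii by (auto simp: w_core_invertible_def)
    obtain z where z: "is_core_inverse (a ^ n) z"
      using inv by (auto simp: core_invertible_def)
    \<comment> \<open>Both \<open>a ^ n * y\<close> and \<open>a ^ (n - 1) * z\<close> are pseudo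
      core inverses of \<open>a\<close>, so uniqueness identifies them.\<close>
    show ?thesis
      using pseudo_core_inverse_eqI[OF is_pseudo_core_inverse_exp_of_w_core[OF n y]]
        pseudo_core_inverse_eqI[OF is_pseudo_core_inverse_exp_of_core[OF n z]]
      by (simp add: w_core_inverse_eqI[OF y] core_inverse_eqI[OF z])
  qed
  then show ?thesis
    using i_ii i_iii pseudo_core_index_le_iff[of a n] by blast
qed

end
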